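(* Let $0\le\delta<\lambda$ be real numbers. Let $f$ be a continuous positive real function on the interval $[\delta,\lambda]$, twice differentiable on $(\delta,\lambda)$ with $f'(u)<0$ and $f''(u)<0$ for all $u\in(\delta,\lambda)$. Let $a,b$ be real numbers with $\delta<a\le b<\lambda$. Then $$\frac{f(\lambda)\,f(a)}{f(b)\,f(\lambda a/b)}\le 1.$$ *)

theory Defs
  imports Complex_Main
begin

end

theory Submission
  imports Defs
begin

text \<open>With \<open>k = \<Lambda> / b\<close> the claim is \<open>g b \<le> g a\<close> for \<open>g u = f (k * u) / f u\<close>.  This \<open>g\<close> is
  decreasing: since \<open>u \<le> k * u\<close>, both \<open>f\<close> and \<open>f'\<close> are smaller at \<open>k * u\<close> than at \<open>u\<close>, whence
  \<open>k * f' (k * u) * f u \<le> f' (k * u) * f (k * u) \<le> f' u * f (k * u)\<close>.\<close>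

theorem lemma9:
  fixes f f' f'' :: "real \<Rightarrow> real" and \<delta> \<Lambda> a b :: real
  assumes "0 \<le> \<delta>" and "\<delta> < \<Lambda>"
    and "continuous_on {\<delta>..\<Lambda>} f"
    and "\<And>u. u \<in> {\<delta>..\<Lambda>} \<Longrightarrow> f u > 0"
    and "\<And>u. u \<in> {\<delta><..<\<Lambda>} \<Longrightarrow> (f has_real_derivative f' u) (at u)"
    and "\<And>u. u \<in> {\<delta><..<\<Lambda>} \<Longrightarrow> (f' has_real_derivative f'' u) (at u)"
    and "\<And>u. u \<in> {\<delta><..<\<Lambda>} \<Longrightarrow> f' u < 0"
    and "\<And>u. u \<in> {\<delta><..<\<Lambda>} \<Longrightarrow> f'' u < 0"
    and "\<delta> < a" and "a \<le> b" and "b < \<Lambda>"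
  shows "(f \<Lambda> * f a) / (f b * f (\<Lambda> * a / b)) \<le> 1"
proof -
  define k where "k = \<Lambda> / b"
  define g where "g = (\<lambda>u. f (k * u) / f u)"
  have b: "0 < b" and k: "1 < k" "k * b = \<Lambda>"
    using assms(1,9-11) by (auto simp: k_def)
  \<comment> \<open>These bounds keep both \<open>u\<close> and \<open>k * u\<close> in the domain
    of \<open>f\<close>. The first uses \<open>u > 0\<close>, which comes from
    \<open>0 \<le> \<delta>\<close>; the second is an equality at \<open>u = b\<close>.\<close>
  have ku: "u \<le> k * u" "k * u \<le> \<Lambda>" "\<delta> < u" "u < \<Lambda>" if "u \<in> {a..b}" for u
  proof -
    show "\<delta> < u" "u < \<Lambda>" using that assms(9,11) by auto
    then show "u \<le> k * u" using k assms(1) by (simp add: mult_le_cancel_right1)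
    show "k * u \<le> \<Lambda>" using that k by (metis atLeastAtMost_iff mult_left_mono less_eq_real_def less_trans zero_less_one)
  qed
  have pos: "f u > 0" "f (k * u) > 0" if "u \<in> {a..b}" for u
    using ku[OF that] assms(4) by auto
  have "g b \<le> g a"
  \<comment> \<open>The version with derivatives on the open interval only is essential: at
    \<open>u = b\<close> the argument \<open>k * u\<close> is the endpoint \<open>\<Lambda>\<close>,
    where \<open>f\<close> is merely known to be continuous.\<close>
  proof (rule DERIV_nonpos_imp_decreasing_open[OF \<open>a \<le> b\<close>])
    fix u assume u: "a < u" "u < b"
    then have uab: "u \<in> {a..b}" by simp
    note ku' = ku[OF uab] and pos' = pos[OF uab]
    have "k * u < \<Lambda>" using u k by (metis mult_less_cancel_left_pos less_trans zero_less_one)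
    then have in_dom: "u \<in> {\<delta><..<\<Lambda>}" "k * u \<in> {\<delta><..<\<Lambda>}" using ku' by auto
    \<comment> \<open>The whole segment from \<open>u\<close> to \<open>k * u\<close> avoids the
      endpoints, so the signs of \<open>f'\<close> and \<open>f''\<close> make \<open>f\<close> and
      \<open>f'\<close> decrease along it.\<close>
    have seg: "x \<in> {\<delta><..<\<Lambda>}" if "u \<le> x" "x \<le> k * u" for x
      using that in_dom by auto
    have f_le: "f (k * u) \<le> f u"
      by (rule DERIV_nonpos_imp_nonincreasing[OF ku'(1)]) (use seg assms(5,7) in \<open>blast intro: less_imp_le\<close>)
    have f'_le: "f' (k * u) \<le> f' u"
      by (rule DERIV_nonpos_imp_nonincreasing[OF ku'(1)]) (use seg assms(6,8) in \<open>blast intro: less_imp_le\<close>)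
    have neg: "f' (k * u) < 0" using assms(7) in_dom by blast
    let ?d = "(f' (k * u) * k * f u - f (k * u) * f' u) / (f u * f u)"
    have "((\<lambda>u. f (k * u)) has_real_derivative f' (k * u) * k) (at u)"
      by (rule DERIV_chain2[where f = f and g = "(*) k", OF assms(5)[OF in_dom(2)]]) (auto intro!: derivative_eq_intros)
    then have deriv: "(g has_real_derivative ?d) (at u)"
      unfolding g_def using DERIV_divide assms(5)[OF in_dom(1)] pos'(1) by fastforce
    \<comment> \<open>Here \<open>k > 1\<close> and \<open>f u > 0\<close> give
      \<open>f u \<le> k * f u\<close>. Multiplying by the negative \<open>f' (k * u)\<close> then
      reverses the inequality.\<close>
    have "f (k * u) \<le> k * f u"
      using f_le k pos' mult_right_mono[of 1 k "f u"] by linarith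
    then have "f' (k * u) * (k * f u) \<le> f' (k * u) * f (k * u)"
      using neg by (simp add: mult_left_mono_neg)
    also have "\<dots> \<le> f' u * f (k * u)"
      using f'_le pos' by (simp add: mult_right_mono)
    finally have "?d \<le> 0"
      using pos' by (simp add: divide_nonpos_pos algebra_simps)
    with deriv show "\<exists>y. (g has_real_derivative y) (at u) \<and> y \<le> 0" by blast
  next
    have "continuous_on {a..b} (\<lambda>u. f (k * u))"
      by (rule continuous_on_compose2[OF assms(3)]) (use ku in \<open>force intro!: continuous_intros\<close>)+
    moreover have "continuous_on {a..b} f"
      by (rule continuous_on_subset[OF assms(3)]) (use assms(9,11) in auto)
    ultimately show "continuous_on {a..b} g"
      unfolding g_def using pos by (force intro!: continuous_on_divide)
  qed
  \<comment> \<open>At \<open>u = b\<close> the argument \<open>k * u\<close> is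
    \<open>\<Lambda>\<close>, and at \<open>u = a\<close> it is \<open>\<Lambda> * a / b\<close>.
    Positivity of all four values then permits cross-multiplication.\<close>
  then have "f \<Lambda> / f b \<le> f (\<Lambda> * a / b) / f a"
    using k by (simp add: g_def k_def)
  then show ?thesis
    using pos[of a] pos[of b] \<open>a \<le> b\<close> by (simp add: k_def field_simps)
qed

end
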